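(* Let $X$ be a finite-dimensional real Hilbert space, let $Z$ be a closed convex subset of $X$, and let $(x_n)_{n\in\mathbb{N}}$ be a sequence in $X$ that is Fejér monotone with respect to $Z$. Suppose that $(x_n)_{n\in\mathbb{N}}$ converges to some $\bar z\in Z$, that $x_{n+1}\neq x_n$ and $x_n\neq\bar z$ for every $n\in\mathbb{N}$, that the interior of $Z$ is nonempty, and that $N_Z(\bar z)$ is a ray. Then both of the following limits exist, they coincide, and their common value lies in $\mathbb{S}\cap N_Z(\bar z)$: $$\lim_{n\to\infty}\frac{x_n-x_{n+1}}{\|x_n-x_{n+1}\|}=\lim_{n\to\infty}\frac{x_n-\bar z}{\|x_n-\bar z\|}\in \mathbb{S}\cap N_Z(\bar z).$$
   Context: $X$ has inner product $\langle\cdot,\cdot\rangle$ and induced norm $\|\cdot\|$; $\mathbb{N}=\{0,1,2,\ldots\}$. A sequence $(x_n)_{n\in\mathbb{N}}$ in $X$ is Fejér monotone with respect to $C\subseteq X$ if $\|x_{n+1}-c\|\le\|x_n-c\|$ for all $c\in C$ and all $n\in\mathbb{N}$. $\mathbb{S}=\{x\in X:\|x\|=1\}$ is the unit sphere. For $z\in C\subseteq X$, the normal cone of $C$ at $z$ is $N_C(z)=\{u\in X:\langle c-z,u\rangle\le 0 \text{ for all } c\in C\}$. A ray is a set of the form $\{\lambda u:\lambda\ge 0\}$ with $u\in X\setminus\{0\}$. *)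

theory Defs
  imports "HOL-Analysis.Analysis"
begin

definition fejer_monotone :: "(nat \<Rightarrow> 'a::real_inner) \<Rightarrow> 'a set \<Rightarrow> bool" where
  "fejer_monotone x C \<longleftrightarrow> (\<forall>c\<in>C. \<forall>n. norm (x (Suc n) - c) \<le> norm (x n - c))"

text \<open>Only used for points \<open>z \<in> C\<close>; no convention for other points is built in.\<close>

definition normal_cone :: "'a::real_inner set \<Rightarrow> 'a \<Rightarrow> 'a set" where
  "normal_cone C z = {u. \<forall>c\<in>C. (c - z) \<bullet> u \<le> 0}"

definition is_ray :: "'a::real_vector set \<Rightarrow> bool" where
  "is_ray R \<longleftrightarrow> (\<exists>u. u \<noteq> 0 \<and> R = {t *\<^sub>R u | t. 0 \<le> t})"

end

theory Submission
  imports Defs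
begin

text \<open>
  Let \<open>d n = x n - x (Suc n)\<close>.  Expanding the square in the Fejer inequality for \<open>c \<in> Z\<close> gives
  \<open>(c - x n) \<bullet> d n \<le> 0\<close>.  Dividing by \<open>norm (d n)\<close> and using that \<open>x n\<close> tends to \<open>zbar\<close>,
  every cluster point of the unit vectors \<open>d n / norm (d n)\<close> is a unit vector of the normal cone at
  \<open>zbar\<close>.  A ray contains exactly one unit vector \<open>l\<close>, so compactness of the sphere forces the
  normalized steps to converge to \<open>l\<close> (lemmas \<open>fejer_step_cluster_point_normal\<close> and
  \<open>compact_unique_cluster_point_tendsto\<close>).

  The second limit follows from the first one alone.  The residual \<open>x n - zbar\<close> is the sum of the
  remaining steps \<open>d k\<close>, \<open>k \<ge> n\<close>.  For large \<open>n\<close> all of these lie in the narrow circular cone of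
  vectors \<open>y\<close> with \<open>a * norm y \<le> y \<bullet> l\<close>, where \<open>a < 1\<close> is close to \<open>1\<close>.  This cone is closed under
  addition and topologically closed, so it contains the residual, whose direction is therefore close
  to \<open>l\<close> (lemma \<open>residual_direction_tendsto\<close>).
\<close>

lemma compact_unique_cluster_point_tendsto:
  fixes v :: "nat \<Rightarrow> 'a::metric_space"
  assumes "compact K" and in_K: "\<And>n. v n \<in> K"
    and unique: "\<And>r w. strict_mono r \<Longrightarrow> (v \<circ> r) \<longlonglongrightarrow> w \<Longrightarrow> w = l"
  shows "v \<longlonglongrightarrow> l"
proof (rule ccontr)
  assume "\<not> v \<longlonglongrightarrow> l"
  then obtain e where e: "e > 0" "\<not> (\<forall>\<^sub>F n in sequentially. dist (v n) l < e)"
    unfolding tendsto_iff by blast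
  obtain r :: "nat \<Rightarrow> nat" where r: "strict_mono r" and far: "\<And>n. \<not> dist (v (r n)) l < e"
    using not_eventually_sequentiallyD[OF e(2)] by blast
  obtain w s where s: "strict_mono (s :: nat \<Rightarrow> nat)" and w: "((v \<circ> r) \<circ> s) \<longlonglongrightarrow> w"
    using \<open>compact K\<close> in_K unfolding compact_def by (metis comp_apply)
  have "w = l"
    using unique[OF strict_mono_o[OF r s]] w by (simp add: comp_assoc)
  then have "\<forall>\<^sub>F n in sequentially. dist (v (r (s n))) l < e"
    using w e(1) by (auto simp: tendsto_iff)
  then show False
    using far by (simp add: eventually_sequentially)
qed

text \<open>
  Moving closer to \<open>c\<close> requires a step that makes a nonobtuse angle with \<open>c - x n\<close>: the squared
  distances differ by \<open>2 * ((c - x n) \<bullet> (x n - x (Suc n)))\<close> plus the square of the step length.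
\<close>

lemma fejer_step_inner_nonpos:
  fixes x :: "nat \<Rightarrow> 'a::real_inner"
  assumes "fejer_monotone x C" "c \<in> C"
  shows "(c - x n) \<bullet> (x n - x (Suc n)) \<le> 0"
proof -
  have "(norm (x (Suc n) - c))\<^sup>2 \<le> (norm (x n - c))\<^sup>2"
    using assms by (auto simp: fejer_monotone_def intro: power_mono)
  moreover have "(norm (x (Suc n) - c))\<^sup>2 = (norm (x n - c))\<^sup>2
      + 2 * ((c - x n) \<bullet> (x n - x (Suc n))) + (norm (x n - x (Suc n)))\<^sup>2"
    by (simp add: power2_norm_eq_inner algebra_simps inner_commute)
  ultimately show ?thesis
    using zero_le_power2[of "norm (x n - x (Suc n))"] by linarith
qed

lemma fejer_step_cluster_point_normal:
  fixes x :: "nat \<Rightarrow> 'a::real_inner"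
  assumes "fejer_monotone x C" "x \<longlonglongrightarrow> z" "strict_mono r"
    and w: "(\<lambda>n. (x (r n) - x (Suc (r n))) /\<^sub>R norm (x (r n) - x (Suc (r n)))) \<longlonglongrightarrow> w"
  shows "w \<in> normal_cone C z"
  unfolding normal_cone_def
proof (intro CollectI ballI)
  fix c assume c: "c \<in> C"
  have "(\<lambda>n. x (r n)) \<longlonglongrightarrow> z"
    using LIMSEQ_subseq_LIMSEQ[OF assms(2,3)] by (simp add: o_def)
  then have "(\<lambda>n. (c - x (r n)) \<bullet>
      ((x (r n) - x (Suc (r n))) /\<^sub>R norm (x (r n) - x (Suc (r n))))) \<longlonglongrightarrow> (c - z) \<bullet> w"
    by (intro tendsto_intros w)
  moreover have "(c - x (r n)) \<bullet>
      ((x (r n) - x (Suc (r n))) /\<^sub>R norm (x (r n) - x (Suc (r n)))) \<le> 0" for n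
    using fejer_step_inner_nonpos[OF assms(1) c, of "r n"]
    by (simp add: divide_nonpos_nonneg flip: divide_inverse_commute)
  ultimately show "(c - z) \<bullet> w \<le> 0"
    by (intro LIMSEQ_le_const2) auto
qed

lemma ray_unit_vector:
  fixes R :: "'a::real_normed_vector set"
  assumes "is_ray R"
  obtains l where "l \<in> sphere 0 1 \<inter> R" "\<And>w. w \<in> sphere 0 1 \<inter> R \<Longrightarrow> w = l"
proof -
  obtain u where u: "u \<noteq> 0" and R: "R = {t *\<^sub>R u | t. 0 \<le> t}"
    using assms by (auto simp: is_ray_def)
  show ?thesis
  proof
    show "u /\<^sub>R norm u \<in> sphere 0 1 \<inter> R"
      using u by (auto simp: R intro!: exI[of _ "inverse (norm u)"])
  next
    fix w assume "w \<in> sphere 0 1 \<inter> R"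
    then obtain t where "w = t *\<^sub>R u" "t * norm u = 1"
      unfolding R by force
    with u show "w = u /\<^sub>R norm u"
      by (simp add: field_simps)
  qed
qed

text \<open>
  Cosines measure distances on the unit sphere, because \<open>(dist u l)\<^sup>2 = 2 - 2 * (u \<bullet> l)\<close> for unit
  vectors.  This turns convergence of directions into membership in circular cones around \<open>l\<close>.
\<close>

lemma unit_vectors_tendsto_iff_inner_tendsto:
  fixes u :: "nat \<Rightarrow> 'a::real_inner"
  assumes "\<And>n. norm (u n) = 1" "norm l = 1"
  shows "u \<longlonglongrightarrow> l \<longleftrightarrow> (\<lambda>n. u n \<bullet> l) \<longlonglongrightarrow> 1"
proof
  assume "u \<longlonglongrightarrow> l"
  then have "(\<lambda>n. u n \<bullet> l) \<longlonglongrightarrow> l \<bullet> l"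
    by (intro tendsto_intros)
  then show "(\<lambda>n. u n \<bullet> l) \<longlonglongrightarrow> 1"
    using assms by (simp add: norm_eq_1)
next
  assume "(\<lambda>n. u n \<bullet> l) \<longlonglongrightarrow> 1"
  then have "(\<lambda>n. sqrt (2 - 2 * (u n \<bullet> l))) \<longlonglongrightarrow> sqrt (2 - 2 * 1)"
    by (intro tendsto_intros)
  moreover have "sqrt (2 - 2 * (u n \<bullet> l)) = norm (u n - l)" for n
    using assms by (simp add: norm_eq_sqrt_inner inner_diff inner_commute)
  ultimately have "(\<lambda>n. norm (u n - l)) \<longlonglongrightarrow> 0"
    by simp
  then show "u \<longlonglongrightarrow> l"
    by (simp add: LIM_zero_iff tendsto_norm_zero_iff)
qed

text \<open>
  If all steps from time \<open>n\<close> on lie in a circular cone, then so does the residual at time \<open>n\<close>: by the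
  triangle inequality the cone contains the partial sums \<open>x n - x (n + m)\<close>, hence also their limit.
\<close>

lemma residual_in_cone:
  fixes x :: "nat \<Rightarrow> 'a::real_inner"
  assumes "x \<longlonglongrightarrow> z" "0 \<le> a"
    and step: "\<And>k. n \<le> k \<Longrightarrow> a * norm (x k - x (Suc k)) \<le> (x k - x (Suc k)) \<bullet> l"
  shows "a * norm (x n - z) \<le> (x n - z) \<bullet> l"
proof -
  have partial: "a * norm (x n - x (n + m)) \<le> (x n - x (n + m)) \<bullet> l" for m
  proof (induction m)
    case 0
    show ?case by simp
  next
    case (Suc m)
    have "norm (x n - x (n + Suc m))
        \<le> norm (x n - x (n + m)) + norm (x (n + m) - x (Suc (n + m)))"
      using norm_triangle_ineq[of "x n - x (n + m)" "x (n + m) - x (Suc (n + m))"] by simp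
    then have "a * norm (x n - x (n + Suc m))
        \<le> a * norm (x n - x (n + m)) + a * norm (x (n + m) - x (Suc (n + m)))"
      using \<open>0 \<le> a\<close> by (metis distrib_left mult_left_mono)
    also have "\<dots> \<le> (x n - x (n + m)) \<bullet> l + (x (n + m) - x (Suc (n + m))) \<bullet> l"
      using Suc step[of "n + m"] by linarith
    finally show ?case
      by (simp add: inner_diff_left)
  qed
  have lim: "(\<lambda>m. x (n + m)) \<longlonglongrightarrow> z"
    using LIMSEQ_ignore_initial_segment[OF assms(1), of n] by (simp add: add.commute)
  have "(\<lambda>m. a * norm (x n - x (n + m))) \<longlonglongrightarrow> a * norm (x n - z)"
    and "(\<lambda>m. (x n - x (n + m)) \<bullet> l) \<longlonglongrightarrow> (x n - z) \<bullet> l"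
    by (intro tendsto_intros lim)+
  then show ?thesis
    using partial by (intro LIMSEQ_le) auto
qed

lemma residual_direction_tendsto:
  fixes x :: "nat \<Rightarrow> 'a::real_inner"
  assumes "x \<longlonglongrightarrow> z" and step_ne: "\<And>n. x (Suc n) \<noteq> x n" and res_ne: "\<And>n. x n \<noteq> z"
    and "norm l = 1"
    and dir: "(\<lambda>n. (x n - x (Suc n)) /\<^sub>R norm (x n - x (Suc n))) \<longlonglongrightarrow> l"
  shows "(\<lambda>n. (x n - z) /\<^sub>R norm (x n - z)) \<longlonglongrightarrow> l"
proof -
  let ?v = "\<lambda>n. (x n - x (Suc n)) /\<^sub>R norm (x n - x (Suc n))"
  let ?u = "\<lambda>n. (x n - z) /\<^sub>R norm (x n - z)"
  have v1: "norm (?v n) = 1" and u1: "norm (?u n) = 1" for n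
    using step_ne[of n] res_ne[of n] by simp_all
  have cos: "(\<lambda>n. ?v n \<bullet> l) \<longlonglongrightarrow> 1"
    using unit_vectors_tendsto_iff_inner_tendsto[of ?v l] v1 \<open>norm l = 1\<close> dir by blast
  have "(\<lambda>n. ?u n \<bullet> l) \<longlonglongrightarrow> 1"
  proof (rule order_tendstoI)
    fix b :: real assume "1 < b"
    moreover have "?u n \<bullet> l \<le> 1" for n
      using norm_cauchy_schwarz[of "?u n" l] unfolding u1 \<open>norm l = 1\<close> by simp
    ultimately show "\<forall>\<^sub>F n in sequentially. ?u n \<bullet> l < b"
      by (intro always_eventually allI) (meson le_less_trans)
  next
    fix b :: real assume "b < 1"
    \<comment> \<open>The cone parameter must be nonnegative for the cone to be convex, and it must exceed \<open>b\<close>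
      to give the strict inequality.\<close>
    then obtain a where a: "max 0 b < a" "a < 1"
      using dense[of "max 0 b" 1] by auto
    obtain N where N: "\<And>k. N \<le> k \<Longrightarrow> a < ?v k \<bullet> l"
      using order_tendstoD(1)[OF cos a(2)] unfolding eventually_sequentially by blast
    have step: "a * norm (x k - x (Suc k)) \<le> (x k - x (Suc k)) \<bullet> l" if "N \<le> k" for k
    proof -
      have "a < ((x k - x (Suc k)) \<bullet> l) / norm (x k - x (Suc k))"
        using N[OF that] by (simp only: inner_scaleR_left divide_inverse_commute)
      then show ?thesis
        using step_ne[of k] by (simp add: pos_less_divide_eq)
    qed
    have "b < ?u n \<bullet> l" if "N \<le> n" for n
    proof -
      have "a * norm (x n - z) \<le> (x n - z) \<bullet> l"
        using a(1) step that by (intro residual_in_cone[OF assms(1)]) auto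
      then have "a \<le> ((x n - z) \<bullet> l) / norm (x n - z)"
        using res_ne[of n] by (simp add: pos_le_divide_eq)
      then have "a \<le> ?u n \<bullet> l"
        by (simp only: inner_scaleR_left divide_inverse_commute)
      then show ?thesis using a(1) by linarith
    qed
    then show "\<forall>\<^sub>F n in sequentially. b < ?u n \<bullet> l"
      unfolding eventually_sequentially by blast
  qed
  then show ?thesis
    using unit_vectors_tendsto_iff_inner_tendsto[of ?u l] u1 \<open>norm l = 1\<close> by blast
qed

theorem corollary3p4:
  fixes Z :: "'a::euclidean_space set"
    and x :: "nat \<Rightarrow> 'a"
    and zbar :: 'a
  assumes "closed Z"
    and "convex Z"
    and "fejer_monotone x Z"
    and "zbar \<in> Z"
    and "x \<longlonglongrightarrow> zbar"
    and "\<And>n. x (Suc n) \<noteq> x n"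
    and "\<And>n. x n \<noteq> zbar"
    and "interior Z \<noteq> {}"
    and "is_ray (normal_cone Z zbar)"
  shows "\<exists>l \<in> sphere 0 1 \<inter> normal_cone Z zbar.
           (\<lambda>n. (x n - x (Suc n)) /\<^sub>R norm (x n - x (Suc n))) \<longlonglongrightarrow> l \<and>
           (\<lambda>n. (x n - zbar) /\<^sub>R norm (x n - zbar)) \<longlonglongrightarrow> l"
proof -
  let ?v = "\<lambda>n. (x n - x (Suc n)) /\<^sub>R norm (x n - x (Suc n))"
  obtain l where l: "l \<in> sphere 0 1 \<inter> normal_cone Z zbar"
    and l_unique: "\<And>w. w \<in> sphere 0 1 \<inter> normal_cone Z zbar \<Longrightarrow> w = l"
    using ray_unit_vector[OF assms(9)] by blast
  have on_sphere: "?v n \<in> sphere 0 1" for n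
    using assms(6)[of n] by simp
  have "?v \<longlonglongrightarrow> l"
  proof (rule compact_unique_cluster_point_tendsto[OF compact_sphere on_sphere])
    fix r w assume r: "strict_mono (r :: nat \<Rightarrow> nat)" and w: "(?v \<circ> r) \<longlonglongrightarrow> w"
    have "w \<in> normal_cone Z zbar"
      using fejer_step_cluster_point_normal[OF assms(3,5) r] w by (simp add: o_def)
    moreover have "w \<in> sphere 0 1"
      using on_sphere by (intro closed_sequentially[OF closed_sphere _ w]) auto
    ultimately show "w = l"
      using l_unique by blast
  qed
  moreover from this have "(\<lambda>n. (x n - zbar) /\<^sub>R norm (x n - zbar)) \<longlonglongrightarrow> l"
    using residual_direction_tendsto[OF assms(5-7)] l by simp
  ultimately show ?thesis
    using l by blast
qed

end
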